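(* Let $n\ge 1$, $N=2^n$, let $x_0\in\{0,1,\dots,N-1\}$ be the unknown marked label, and let $I_{|x_0\rangle}$ be given as an oracle. Run Grover's algorithm as described in the context: prepare $|\psi_0\rangle=H|0\rangle$, apply $Q=-HI_{|0\rangle}HI_{|x_0\rangle}$ to it exactly $$K=\mathrm{round}\left(\frac{\pi}{4\sin^{-1}(1/\sqrt N)}-\frac12\right)$$ times, and measure the resulting state $Q^K|\psi_0\rangle$ with respect to the standard basis $|0\rangle,|1\rangle,\dots,|N-1\rangle$. Then the probability of error (the probability $Prob_E$ that the measurement outcome is not $x_0$) satisfies $$Prob_E\le \frac1N ,$$ and the computational cost of the algorithm is $O(\sqrt N\,\lg N)$.
   Context: Problem: a function $f:\{0,1\}^n\to\{0,1\}$ with $f(x)=1$ if $x=x_0$ and $f(x)=0$ otherwise is given as a black box, and one wants to find $x_0$; $n$-bit strings are identified with integers $0,\dots,N-1$, where $N=2^n$. Let $\mathcal H_2=\mathbb C^2$ with orthonormal basis $|0\rangle,|1\rangle$ and let $\mathcal H=\mathcal H_2^{\otimes n}$ be the $N$-dimensional Hilbert space with induced orthonormal (standard) basis $|0\rangle,|1\rangle,\dots,|N-1\rangle$. For a unit vector $|\psi\rangle\in\mathcal H$ put $I_{|\psi\rangle}=I-2|\psi\rangle\langle\psi|$, where $I$ is the identity. Thus $I_{|x_0\rangle}|x\rangle=(-1)^{f(x)}|x\rangle$ for each standard basis vector $|x\rangle$; this is the oracle. Let $H=\bigotimes_{0}^{n-1}H^{(2)}$ be the Hadamard transform on $\mathcal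 H$, where $H^{(2)}=\frac{1}{\sqrt2}\begin{pmatrix}1&1\\1&-1\end{pmatrix}$ in the basis $|0\rangle,|1\rangle$; so $H^{-1}=H$ and $H|0\rangle=\frac1{\sqrt N}\sum_{j=0}^{N-1}|j\rangle$. Measuring a unit vector $|\psi\rangle$ in the standard basis gives outcome $x$ with probability $|\langle x|\psi\rangle|^2$. The function $\mathrm{round}$ rounds a real number to a nearest integer, and $\lg$ is the base-2 logarithm. Grover's algorithm. Step 0: $|\psi\rangle\leftarrow H|0\rangle$, $k\leftarrow 0$. Step 1: until $k=K$, repeat $|\psi\rangle\leftarrow Q|\psi\rangle$, $k\leftarrow k+1$, where $Q=-HI_{|0\rangle}HI_{|x_0\rangle}$. Step 2: measure $|\psi\rangle$ in the standard basis and output the result. Cost model: the cost is the total number of elementary unitary operations applied. One application of $H$ costs $O(n)=O(\lg N)$ (it consists of $n$ single-qubit operations), and one application of each of $-I_{|0\rangle}$ and $I_{|x_0\rangle}$ costs $O(1)$. The $O$-bound is as $N=2^n$ varies, with a constant independent of $x_0$. *)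

theory Defs
  imports Complex_Main "Jordan_Normal_Form.Matrix"
begin

text \<open>
  The \<open>n\<close>-qubit space is \<open>carrier_vec (2 ^ n)\<close> over the complex numbers; the standard basis
  vector \<open>|j\<rangle>\<close> is \<open>unit_vec (2 ^ n) j\<close>. \<open>tensor_mat\<close> is the Kronecker product, which is the
  tensor product of operators when \<open>|i\<rangle> \<otimes> |j\<rangle>\<close> is identified with \<open>|i * d + j\<rangle>\<close>, \<open>d\<close> the dimension
  of the second factor (bit strings read as binary numbers).
\<close>

definition tensor_mat :: "complex mat \<Rightarrow> complex mat \<Rightarrow> complex mat" where
  "tensor_mat A B =
     mat (dim_row A * dim_row B) (dim_col A * dim_col B)
       (\<lambda>(i, j). A $$ (i div dim_row B, j div dim_col B) * B $$ (i mod dim_row B, j mod dim_col B))"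

definition hadamard2 :: "complex mat" where
  "hadamard2 = complex_of_real (1 / sqrt 2) \<cdot>\<^sub>m mat_of_rows_list 2 [[1, 1], [1, - 1]]"

fun hadamard :: "nat \<Rightarrow> complex mat" where
  "hadamard 0 = 1\<^sub>m 1"
| "hadamard (Suc n) = tensor_mat hadamard2 (hadamard n)"

definition ket_bra :: "complex vec \<Rightarrow> complex mat" where
  "ket_bra \<psi> = mat (dim_vec \<psi>) (dim_vec \<psi>) (\<lambda>(i, j). \<psi> $ i * cnj (\<psi> $ j))"

definition reflection :: "complex vec \<Rightarrow> complex mat" where
  "reflection \<psi> = 1\<^sub>m (dim_vec \<psi>) - 2 \<cdot>\<^sub>m ket_bra \<psi>"

definition grover_Q :: "nat \<Rightarrow> nat \<Rightarrow> complex mat" where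
  "grover_Q n x0 =
     - (hadamard n * reflection (unit_vec (2 ^ n) 0) * hadamard n * reflection (unit_vec (2 ^ n) x0))"

definition grover_start :: "nat \<Rightarrow> complex vec" where
  "grover_start n = hadamard n *\<^sub>v unit_vec (2 ^ n) 0"

text \<open>Ties may be broken arbitrarily. They do occur: for \<open>n = 1\<close> the rounded number is \<open>1 / 2\<close>.\<close>

definition nearest_rounding :: "(real \<Rightarrow> int) \<Rightarrow> bool" where
  "nearest_rounding rnd \<longleftrightarrow> (\<forall>y m. \<bar>real_of_int (rnd y) - y\<bar> \<le> \<bar>real_of_int m - y\<bar>)"

text \<open>For \<open>n \<ge> 1\<close> the rounded number is at least \<open>1 / 2\<close>, so \<open>nat\<close> does not truncate.\<close>

definition grover_K :: "(real \<Rightarrow> int) \<Rightarrow> nat \<Rightarrow> nat" where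
  "grover_K rnd n = nat (rnd (pi / (4 * arcsin (1 / sqrt (2 ^ n))) - 1 / 2))"

definition outcome_prob :: "complex vec \<Rightarrow> nat \<Rightarrow> real" where
  "outcome_prob \<psi> x = (cmod (\<psi> \<bullet>c unit_vec (dim_vec \<psi>) x))\<^sup>2"

definition error_prob :: "complex vec \<Rightarrow> nat \<Rightarrow> real" where
  "error_prob \<psi> x0 = (\<Sum>x \<in> {0..<dim_vec \<psi>} - {x0}. outcome_prob \<psi> x)"

text \<open>
  The cost refers to the sequence of operations the algorithm performs, listed in order of
  application; \<open>run_grover_circuit\<close> below shows that this sequence produces \<open>Q\<^sup>K H |0\<rangle>\<close>.
\<close>

datatype operation = Hadamard | Neg_I0 | Oracle

fun operation_mat :: "nat \<Rightarrow> nat \<Rightarrow> operation \<Rightarrow> complex mat" where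
  "operation_mat n x0 Hadamard = hadamard n"
| "operation_mat n x0 Neg_I0 = - reflection (unit_vec (2 ^ n) 0)"
| "operation_mat n x0 Oracle = reflection (unit_vec (2 ^ n) x0)"

definition run :: "nat \<Rightarrow> nat \<Rightarrow> operation list \<Rightarrow> complex vec \<Rightarrow> complex vec" where
  "run n x0 ops \<psi> = fold (\<lambda>g \<phi>. operation_mat n x0 g *\<^sub>v \<phi>) ops \<psi>"

definition grover_circuit :: "nat \<Rightarrow> operation list" where
  "grover_circuit K = Hadamard # concat (replicate K [Oracle, Hadamard, Neg_I0, Hadamard])"

text \<open>
  \<open>cost n x0 g\<close> is the number of elementary unitary operations used by one application of \<open>g\<close>
  on \<open>n\<close> qubits with marked label \<open>x0\<close>.
\<close>

definition admissible_cost :: "(nat \<Rightarrow> nat \<Rightarrow> operation \<Rightarrow> nat) \<Rightarrow> bool" where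
  "admissible_cost cost \<longleftrightarrow>
     (\<exists>c::real. \<forall>n\<ge>1. \<forall>x0<2 ^ n.
        real (cost n x0 Hadamard) \<le> c * real n \<and>
        real (cost n x0 Neg_I0) \<le> c \<and>
        real (cost n x0 Oracle) \<le> c)"

definition total_cost :: "(operation \<Rightarrow> nat) \<Rightarrow> operation list \<Rightarrow> nat" where
  "total_cost cost ops = sum_list (map cost ops)"

lemma hadamard_carrier [simp]: "hadamard n \<in> carrier_mat (2 ^ n) (2 ^ n)"
  by (induction n) (auto simp: tensor_mat_def hadamard2_def mat_of_rows_list_def)

lemma reflection_unit_carrier [simp]: "reflection (unit_vec N x) \<in> carrier_mat N N"
  by (auto simp: reflection_def ket_bra_def)

lemma grover_Q_carrier [simp]: "grover_Q n x0 \<in> carrier_mat (2 ^ n) (2 ^ n)"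
  by (auto simp: grover_Q_def intro!: mult_carrier_mat[where n = "2 ^ n"])

lemma reflection_unit_vec:
  assumes "x < N"
  shows "reflection (unit_vec N x0) *\<^sub>v unit_vec N x = (if x = x0 then - 1 else 1) \<cdot>\<^sub>v unit_vec N x"
proof (rule eq_vecI)
  fix i assume "i < dim_vec ((if x = x0 then - 1 else 1) \<cdot>\<^sub>v unit_vec N x :: complex vec)"
  then have i: "i < N" by simp
  have "(reflection (unit_vec N x0) *\<^sub>v unit_vec N x) $ i = reflection (unit_vec N x0) $$ (i, x)"
    using i assms by (auto simp: reflection_def ket_bra_def)
  also have "\<dots> = ((if x = x0 then - 1 else 1) \<cdot>\<^sub>v unit_vec N x) $ i"
    using i assms by (auto simp: reflection_def ket_bra_def unit_vec_def)
  finally show "(reflection (unit_vec N x0) *\<^sub>v unit_vec N x) $ i =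
    ((if x = x0 then - 1 else 1) \<cdot>\<^sub>v unit_vec N x) $ i" .
qed (simp add: reflection_def ket_bra_def)

lemma run_iteration:
  assumes "\<phi> \<in> carrier_vec (2 ^ n)"
  shows "run n x0 [Oracle, Hadamard, Neg_I0, Hadamard] \<phi> = grover_Q n x0 *\<^sub>v \<phi>"
proof -
  define N :: nat where "N = 2 ^ n"
  define H where "H = hadamard n"
  define A where "A = reflection (unit_vec N 0)"
  define B where "B = reflection (unit_vec N x0)"
  have H: "H \<in> carrier_mat N N" and A: "A \<in> carrier_mat N N" and B: "B \<in> carrier_mat N N"
    and v: "\<phi> \<in> carrier_vec N"
    using assms by (auto simp: H_def A_def B_def N_def)
  have nA: "- A \<in> carrier_mat N N" using A by simp
  have HA: "H * A \<in> carrier_mat N N" and HnA: "H * - A \<in> carrier_mat N N"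
    using mult_carrier_mat[OF H A] mult_carrier_mat[OF H nA] .
  have HAH: "H * A * H \<in> carrier_mat N N" and HnAH: "H * - A * H \<in> carrier_mat N N"
    using mult_carrier_mat[OF HA H] mult_carrier_mat[OF HnA H] .
  have Bv: "B *\<^sub>v \<phi> \<in> carrier_vec N" by (rule mult_mat_vec_carrier[OF B v])
  have HBv: "H *\<^sub>v (B *\<^sub>v \<phi>) \<in> carrier_vec N" by (rule mult_mat_vec_carrier[OF H Bv])
  have "- (H * A) = H * - A"
    by (rule uminus_mult_right_mat[symmetric]) (use H A in simp)
  moreover have "- (H * A * H) = - (H * A) * H"
    by (rule uminus_mult_left_mat[symmetric]) (use A H in simp)
  moreover have "- (H * A * H * B) = - (H * A * H) * B"
    by (rule uminus_mult_left_mat[symmetric]) (use H B in simp)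
  ultimately have "grover_Q n x0 = H * - A * H * B"
    by (simp add: grover_Q_def H_def A_def B_def N_def)
  then have "grover_Q n x0 *\<^sub>v \<phi> = H *\<^sub>v (- A *\<^sub>v (H *\<^sub>v (B *\<^sub>v \<phi>)))"
    by (simp only: assoc_mult_mat_vec[OF HnAH B v] assoc_mult_mat_vec[OF HnA H Bv]
        assoc_mult_mat_vec[OF H nA HBv])
  then show ?thesis
    by (simp add: run_def H_def A_def B_def N_def)
qed

lemma run_grover_circuit:
  "run n x0 (grover_circuit K) (unit_vec (2 ^ n) 0) = (grover_Q n x0 ^\<^sub>m K) *\<^sub>v grover_start n"
proof -
  have carr: "grover_start n \<in> carrier_vec (2 ^ n)"
    by (auto simp: grover_start_def intro!: mult_mat_vec_carrier[where n = "2 ^ n"])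
  have "run n x0 (concat (replicate K [Oracle, Hadamard, Neg_I0, Hadamard])) \<phi>
      = (grover_Q n x0 ^\<^sub>m K) *\<^sub>v \<phi>" if "\<phi> \<in> carrier_vec (2 ^ n)" for \<phi>
    using that
  proof (induction K arbitrary: \<phi>)
    case 0
    then show ?case by (simp add: run_def carrier_matD[OF grover_Q_carrier])
  next
    case (Suc K)
    have q: "grover_Q n x0 *\<^sub>v \<phi> \<in> carrier_vec (2 ^ n)"
      using Suc.prems by (auto intro!: mult_mat_vec_carrier[where n = "2 ^ n"])
    have "run n x0 (concat (replicate (Suc K) [Oracle, Hadamard, Neg_I0, Hadamard])) \<phi>
        = run n x0 (concat (replicate K [Oracle, Hadamard, Neg_I0, Hadamard])) (grover_Q n x0 *\<^sub>v \<phi>)"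
      using run_iteration[OF Suc.prems, of x0] by (simp add: run_def)
    also have "\<dots> = (grover_Q n x0 ^\<^sub>m K) *\<^sub>v (grover_Q n x0 *\<^sub>v \<phi>)"
      by (rule Suc.IH[OF q])
    also have "\<dots> = (grover_Q n x0 ^\<^sub>m Suc K) *\<^sub>v \<phi>"
      using assoc_mult_mat_vec[OF pow_carrier_mat[OF grover_Q_carrier] grover_Q_carrier Suc.prems]
      by simp
    finally show ?case .
  qed
  from this[OF carr] show ?thesis
    by (simp add: grover_circuit_def grover_start_def run_def)
qed

end

theory Submission
  imports Defs
begin

text \<open>
  With \<open>\<theta> = arcsin (1 / sqrt N)\<close>, the operator \<open>Q\<close> rotates the plane spanned by \<open>|x0\<rangle>\<close> and the
  uniform superposition of the other basis vectors by the angle \<open>2 * \<theta>\<close>, and the starting state has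
  angle \<open>\<theta>\<close> in it. After \<open>K\<close> steps the angle is \<open>(2 * K + 1) * \<theta>\<close>; rounding brings it within \<open>\<theta>\<close>
  of \<open>pi / 2\<close>, so the error probability, the squared cosine, is at most \<open>(sin \<theta>)\<^sup>2 = 1 / N\<close>.
  As \<open>\<theta> \<ge> sin \<theta>\<close>, the number of steps is at most \<open>pi / (4 * \<theta>) \<le> sqrt N\<close>.
\<close>

section \<open>The Hadamard transform\<close>

text \<open>Quotient and remainder by \<open>b\<close> biject the numbers below \<open>a * b\<close>
  with index pairs, the inverse being \<open>i * b + j\<close>. This splits the inner sum in a
  product of Kronecker matrices.\<close>

lemma sum_div_mod:
  fixes f :: "nat \<Rightarrow> nat \<Rightarrow> 'a::comm_monoid_add"
  shows "(\<Sum>k<a * b. f (k div b) (k mod b)) = (\<Sum>i<a. \<Sum>j<b. f i j)"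
proof (cases "b = 0")
  case False
  have pair_less: "i * b + j < a * b" if "i < a" "j < b" for i j
    using mult_le_mono1[of "Suc i" a b] that by simp
  have "(\<Sum>k<a * b. f (k div b) (k mod b)) = (\<Sum>(i, j)\<in>{..<a} \<times> {..<b}. f i j)"
    using False
    by (intro sum.reindex_bij_witness[where i = "\<lambda>(i, j). i * b + j" and j = "\<lambda>k. (k div b, k mod b)"])
      (auto simp: less_mult_imp_div_less intro: pair_less)
  then show ?thesis
    by (simp add: sum.cartesian_product)
qed simp

text \<open>Mixed-product rule: once the summation index is split into quotient and remainder, the
  double sum factors into the entries of \<open>A * C\<close> and \<open>B * D\<close>.\<close>

lemma tensor_mat_mult:
  assumes A: "A \<in> carrier_mat a c" and C: "C \<in> carrier_mat c e"
    and B: "B \<in> carrier_mat b d" and D: "D \<in> carrier_mat d f"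
  shows "tensor_mat A B * tensor_mat C D = tensor_mat (A * C) (B * D)"
proof (rule eq_matI)
  fix i j assume "i < dim_row (tensor_mat (A * C) (B * D))" "j < dim_col (tensor_mat (A * C) (B * D))"
  then have ij: "i < a * b" "j < e * f"
    using assms by (auto simp: tensor_mat_def)
  \<comment> \<open>The indices \<open>i\<close> and \<open>j\<close> witness that both ranges are
    nonempty; the bounds on remainders need positive divisors.\<close>
  then have pos: "b > 0" "f > 0"
    by (auto intro: Nat.gr0I)
  then have bnd: "i div b < a" "i mod b < b" "j div f < e" "j mod f < f"
    using ij by (auto simp: less_mult_imp_div_less)
  have "(tensor_mat A B * tensor_mat C D) $$ (i, j)
      = (\<Sum>k<c * d. A $$ (i div b, k div d) * B $$ (i mod b, k mod d)
          * (C $$ (k div d, j div f) * D $$ (k mod d, j mod f)))"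
    using ij assms by (auto simp: tensor_mat_def scalar_prod_def atLeast0LessThan intro!: sum.cong)
  also have "\<dots> = (\<Sum>k<c. \<Sum>l<d. A $$ (i div b, k) * B $$ (i mod b, l)
          * (C $$ (k, j div f) * D $$ (l, j mod f)))"
    by (rule sum_div_mod)
  also have "\<dots> = (\<Sum>k<c. A $$ (i div b, k) * C $$ (k, j div f))
      * (\<Sum>l<d. B $$ (i mod b, l) * D $$ (l, j mod f))"
    by (simp add: sum_product mult_ac)
  also have "\<dots> = tensor_mat (A * C) (B * D) $$ (i, j)"
    using ij bnd assms by (simp add: tensor_mat_def scalar_prod_def atLeast0LessThan)
  finally show "(tensor_mat A B * tensor_mat C D) $$ (i, j) = tensor_mat (A * C) (B * D) $$ (i, j)" .
qed (use assms in \<open>auto simp: tensor_mat_def\<close>)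

lemma tensor_mat_one: "tensor_mat (1\<^sub>m a) (1\<^sub>m b) = 1\<^sub>m (a * b)"
proof (rule eq_matI)
  fix i j assume "i < dim_row (1\<^sub>m (a * b) :: complex mat)" "j < dim_col (1\<^sub>m (a * b) :: complex mat)"
  then have ij: "i < a * b" "j < a * b" by auto
  then have "b > 0" by (auto intro: Nat.gr0I)
  moreover have "i = j \<longleftrightarrow> i div b = j div b \<and> i mod b = j mod b"
    by (metis div_mult_mod_eq)
  ultimately show "tensor_mat (1\<^sub>m a) (1\<^sub>m b) $$ (i, j) = 1\<^sub>m (a * b) $$ (i, j)"
    using ij by (auto simp: tensor_mat_def less_mult_imp_div_less)
qed (auto simp: tensor_mat_def)

lemma hadamard2_carrier: "hadamard2 \<in> carrier_mat 2 2"
  by (auto simp: hadamard2_def mat_of_rows_list_def)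

lemma hadamard2_index:
  assumes "i < 2" "j < 2"
  shows "hadamard2 $$ (i, j) = (if i = 1 \<and> j = 1 then - 1 else 1) / complex_of_real (sqrt 2)"
  using assms by (auto simp: hadamard2_def mat_of_rows_list_def less_2_cases_iff)

lemma hadamard2_mult_self: "hadamard2 * hadamard2 = 1\<^sub>m 2"
proof (rule eq_matI)
  have "complex_of_real (sqrt 2) * complex_of_real (sqrt 2) = 2"
    by (simp flip: of_real_mult)
  moreover fix i j assume "i < dim_row (1\<^sub>m 2 :: complex mat)" "j < dim_col (1\<^sub>m 2 :: complex mat)"
  ultimately show "(hadamard2 * hadamard2) $$ (i, j) = 1\<^sub>m 2 $$ (i, j)"
    using hadamard2_carrier
    by (auto simp: scalar_prod_def numeral_2_eq_2 less_Suc_eq hadamard2_index)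
qed (use hadamard2_carrier in auto)

lemma hadamard_dims [simp]: "dim_row (hadamard n) = 2 ^ n" "dim_col (hadamard n) = 2 ^ n"
  by (rule carrier_matD[OF hadamard_carrier])+

text \<open>The mixed-product rule reduces the square to that of the single-qubit factor and the
  induction hypothesis.\<close>

lemma hadamard_mult_self: "hadamard n * hadamard n = 1\<^sub>m (2 ^ n)"
proof (induction n)
  case (Suc n)
  then show ?case
    using tensor_mat_mult[OF hadamard2_carrier hadamard2_carrier hadamard_carrier[of n] hadamard_carrier[of n]]
    by (simp add: hadamard2_mult_self tensor_mat_one)
qed simp

text \<open>The only negative entry of \<open>hadamard2\<close> sits at (1, 1), so row 0 and column
  0 of the tensor power never meet it and collect one factor 1 / sqrt 2 per qubit.\<close>

lemma hadamard_first:
  assumes "i < 2 ^ n"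
  shows "hadamard n $$ (i, 0) = 1 / complex_of_real (sqrt (2 ^ n))"
    and "hadamard n $$ (0, i) = 1 / complex_of_real (sqrt (2 ^ n))"
proof -
  have "hadamard n $$ (i, 0) = 1 / complex_of_real (sqrt (2 ^ n)) \<and>
      hadamard n $$ (0, i) = 1 / complex_of_real (sqrt (2 ^ n))"
    using assms
  proof (induction n arbitrary: i)
    case (Suc n)
    have dims: "dim_row hadamard2 = 2" "dim_col hadamard2 = 2"
      using hadamard2_carrier by auto
    have "i div 2 ^ n < 2" "i mod 2 ^ n < 2 ^ n"
      using Suc.prems by (auto intro!: less_mult_imp_div_less)
    then show ?case
      using Suc.prems by (simp_all add: tensor_mat_def dims hadamard2_index Suc.IH real_sqrt_mult)
  qed simp
  then show "hadamard n $$ (i, 0) = 1 / complex_of_real (sqrt (2 ^ n))"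
    and "hadamard n $$ (0, i) = 1 / complex_of_real (sqrt (2 ^ n))"
    by auto
qed

lemma grover_start_eq: "grover_start n = vec (2 ^ n) (\<lambda>i. 1 / complex_of_real (sqrt (2 ^ n)))"
  by (intro eq_vecI) (auto simp: grover_start_def hadamard_first)

section \<open>Grover iteration as a rotation\<close>

text \<open>The product \<open>\<bullet>c\<close> conjugates its second argument, so
  \<open>w \<bullet>c \<psi>\<close> is the bracket of \<psi> with w in Dirac notation.\<close>

lemma reflection_mult_vec:
  assumes "w \<in> carrier_vec (dim_vec \<psi>)"
  shows "reflection \<psi> *\<^sub>v w = w - (2 * (w \<bullet>c \<psi>)) \<cdot>\<^sub>v \<psi>"
proof (rule eq_vecI)
  fix i assume "i < dim_vec (w - (2 * (w \<bullet>c \<psi>)) \<cdot>\<^sub>v \<psi>)"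
  then have i: "i < dim_vec \<psi>" using assms by simp
  have "(reflection \<psi> *\<^sub>v w) $ i
      = (\<Sum>k<dim_vec \<psi>. (if k = i then w $ k else 0) - 2 * (\<psi> $ i * cnj (\<psi> $ k)) * w $ k)"
    using i assms
    by (auto simp: reflection_def ket_bra_def scalar_prod_def atLeast0LessThan algebra_simps
        intro!: sum.cong)
  also have "\<dots> = w $ i - 2 * (\<Sum>k<dim_vec \<psi>. w $ k * cnj (\<psi> $ k)) * \<psi> $ i"
    using i by (simp add: sum_subtractf sum_distrib_left sum_distrib_right mult_ac)
  also have "\<dots> = (w - (2 * (w \<bullet>c \<psi>)) \<cdot>\<^sub>v \<psi>) $ i"
    using i assms by (simp add: scalar_prod_def atLeast0LessThan)
  finally show "(reflection \<psi> *\<^sub>v w) $ i = (w - (2 * (w \<bullet>c \<psi>)) \<cdot>\<^sub>v \<psi>) $ i" .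
qed (use assms in \<open>simp add: reflection_def ket_bra_def\<close>)

lemma inner_unit_vec:
  fixes w :: "complex vec"
  assumes "w \<in> carrier_vec N" "x < N"
  shows "w \<bullet>c unit_vec N x = w $ x"
  using assms by (simp add: scalar_prod_def unit_vec_def if_distrib cong: if_cong)

lemma reflection_unit_mult_vec:
  assumes "w \<in> carrier_vec N" "x < N"
  shows "reflection (unit_vec N x) *\<^sub>v w = vec N (\<lambda>i. if i = x then - w $ i else w $ i)"
  using assms by (auto simp: reflection_mult_vec inner_unit_vec)

text \<open>Inversion about the mean: since H is an involution, -H I_0 H is twice the projection
  onto H|0> minus the identity, and it acts on the state \<open>w\<close> left by the
  oracle.\<close>

lemma grover_Q_mult_vec:
  assumes "\<phi> \<in> carrier_vec (2 ^ n)" "x0 < 2 ^ n"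
  defines "w \<equiv> reflection (unit_vec (2 ^ n) x0) *\<^sub>v \<phi>"
  shows "grover_Q n x0 *\<^sub>v \<phi> = vec (2 ^ n) (\<lambda>i. 2 / 2 ^ n * (\<Sum>k<2 ^ n. w $ k) - w $ i)"
proof -
  define N :: nat where "N = 2 ^ n"
  define H where "H = hadamard n"
  define s where "s = 1 / complex_of_real (sqrt (2 ^ n))"
  have Npos: "0 < N" by (simp add: N_def)
  have H: "H \<in> carrier_mat N N" by (simp add: H_def N_def)
  have w: "w \<in> carrier_vec N"
    using assms(1) unfolding w_def N_def by (auto intro!: mult_mat_vec_carrier[where n = "2 ^ n"])
  define u where "u = H *\<^sub>v w"
  have u: "u \<in> carrier_vec N"
    unfolding u_def by (rule mult_mat_vec_carrier[OF H w])
  have u0: "u $ 0 = s * (\<Sum>k<N. w $ k)"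
    using H w Npos
    by (simp add: u_def scalar_prod_def H_def N_def hadamard_first s_def sum_distrib_left atLeast0LessThan)
  have Hu: "H *\<^sub>v u = w"
    unfolding u_def assoc_mult_mat_vec[OF H H w, symmetric]
    using hadamard_mult_self[of n] w by (simp add: H_def N_def)
  have ss: "s * s = 1 / 2 ^ n"
    by (simp add: s_def flip: of_real_mult)
  \<comment> \<open>This is twice the mean of \<open>w\<close>: one factor \<open>s\<close> comes
    from row 0 of H, the other from the entries of H|0>.\<close>
  have u0s: "2 * u $ 0 * s = 2 / 2 ^ n * (\<Sum>k<N. w $ k)"
  proof -
    have "2 * u $ 0 * s = 2 * (s * s) * (\<Sum>k<N. w $ k)" by (simp add: u0 mult_ac)
    then show ?thesis by (simp add: ss)
  qed
  have uc: "u \<bullet>c unit_vec N 0 = u $ 0"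
    by (rule inner_unit_vec[OF u Npos])
  have neg: "- reflection (unit_vec N 0) *\<^sub>v u = (2 * u $ 0) \<cdot>\<^sub>v unit_vec N 0 - u"
  proof -
    have "- reflection (unit_vec N 0) *\<^sub>v u = - (reflection (unit_vec N 0) *\<^sub>v u)"
      using u by (intro eq_vecI) (auto simp: reflection_def ket_bra_def scalar_prod_def sum_negf[symmetric])
    also have "\<dots> = (2 * u $ 0) \<cdot>\<^sub>v unit_vec N 0 - u"
      using u by (auto simp: reflection_mult_vec uc)
    finally show ?thesis .
  qed
  \<comment> \<open>Expanding via \<open>run_iteration\<close> gives the form in which the sign
    already sits on the reflection.\<close>
  have "grover_Q n x0 *\<^sub>v \<phi> = H *\<^sub>v (- reflection (unit_vec N 0) *\<^sub>v u)"
    using run_iteration[OF assms(1), of x0] by (simp add: run_def u_def w_def H_def N_def)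
  also have "\<dots> = (2 * u $ 0) \<cdot>\<^sub>v (H *\<^sub>v unit_vec N 0) - w"
    unfolding neg
    by (subst mult_minus_distrib_mat_vec[OF H _ u]) (use H in \<open>auto simp: mult_mat_vec Hu\<close>)
  also have "\<dots> = vec N (\<lambda>i. 2 / 2 ^ n * (\<Sum>k<N. w $ k) - w $ i)"
    using w grover_start_eq[of n] u0s
    by (intro eq_vecI) (auto simp: H_def N_def grover_start_def[symmetric] s_def[symmetric])
  finally show ?thesis by (simp add: N_def)
qed

text \<open>The point at angle \<phi> on the real unit circle spanned by the marked vector and the
  normalized superposition of the other \<open>2 ^ n - 1\<close> basis vectors, whence the square
  root.\<close>

definition grover_state :: "nat \<Rightarrow> nat \<Rightarrow> real \<Rightarrow> complex vec" where
  "grover_state n x0 \<phi> =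
     vec (2 ^ n) (\<lambda>i. complex_of_real (if i = x0 then sin \<phi> else cos \<phi> / sqrt (2 ^ n - 1)))"

definition grover_angle :: "nat \<Rightarrow> real" where
  "grover_angle n = arcsin (1 / sqrt (2 ^ n))"

lemma sin_grover_angle: "sin (grover_angle n) = 1 / sqrt (2 ^ n)"
proof -
  have "1 / sqrt (2 ^ n) \<le> 1" "- 1 \<le> 1 / sqrt (2 ^ n)" by (auto intro: order_trans[of _ 0])
  then show ?thesis by (simp add: grover_angle_def)
qed

lemma cos_grover_angle: "cos (grover_angle n) = sqrt (2 ^ n - 1) / sqrt (2 ^ n)"
proof -
  have "1 / sqrt (2 ^ n) \<le> 1" "- 1 \<le> 1 / sqrt (2 ^ n)" by (auto intro: order_trans[of _ 0])
  then have "cos (grover_angle n) = sqrt (1 - 1 / 2 ^ n)"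
    by (simp add: grover_angle_def cos_arcsin power_divide)
  then show ?thesis by (simp add: diff_divide_distrib flip: real_sqrt_divide)
qed

lemma two_le_power:
  assumes "n \<ge> 1"
  shows "(2::real) \<le> 2 ^ n"
  using power_increasing[OF assms, of "2::real"] by simp

text \<open>The factor \<open>sqrt (2 ^ n - 1)\<close> in the cosine of the angle cancels the
  normalization, leaving equal amplitudes; the cancellation needs \<open>n \<ge> 1\<close>.\<close>

lemma grover_start_state:
  assumes "n \<ge> 1"
  shows "grover_start n = grover_state n x0 (grover_angle n)"
proof -
  have "sqrt (2 ^ n - 1) \<noteq> (0::real)"
    using two_le_power[OF assms] by simp
  then show ?thesis
    by (auto simp: grover_start_eq grover_state_def sin_grover_angle cos_grover_angle)
qed

text \<open>The oracle negates the marked amplitude; inversion about the mean then yields exactly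
  the addition formulas for an increment of twice the angle.\<close>

lemma grover_Q_state:
  assumes "n \<ge> 1" "x0 < 2 ^ n"
  shows "grover_Q n x0 *\<^sub>v grover_state n x0 \<phi> = grover_state n x0 (\<phi> + 2 * grover_angle n)"
proof -
  define M :: real where "M = 2 ^ n"
  define r where "r = sqrt (M - 1)"
  define b where "b = cos \<phi> / r"
  have M: "M \<ge> 2" unfolding M_def by (rule two_le_power[OF assms(1)])
  then have r: "r > 0" "r * r = M - 1" by (simp_all add: r_def)
  have rb: "r * b = cos \<phi>" "(M - 1) * b = r * cos \<phi>"
    using r(1) by (simp_all add: b_def flip: r(2))
  define w where "w = reflection (unit_vec (2 ^ n) x0) *\<^sub>v grover_state n x0 \<phi>"
  have w: "w = vec (2 ^ n) (\<lambda>i. complex_of_real (if i = x0 then - sin \<phi> else b))"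
    using assms by (auto simp: w_def reflection_unit_mult_vec grover_state_def b_def r_def M_def)
  have "(\<Sum>k<2 ^ n. w $ k) = (\<Sum>k<2 ^ n. complex_of_real (if k = x0 then - sin \<phi> else b))"
    by (simp add: w)
  also have "\<dots> = complex_of_real (- sin \<phi> + (\<Sum>k\<in>{..<2 ^ n} - {x0}. b))"
    using assms by (subst sum.remove[of _ x0]) auto
  \<comment> \<open>The \<open>M - 1\<close> equal unmarked amplitudes sum to
    \<open>(M - 1) * b\<close>, which is \<open>r * cos \<phi>\<close> because
    \<open>r * r = M - 1\<close>.\<close>
  also have "- sin \<phi> + (\<Sum>k\<in>{..<2 ^ n} - {x0}. b) = r * cos \<phi> - sin \<phi>"
    using assms rb(2) by (simp add: M_def of_nat_diff)
  finally have sum: "(\<Sum>k<2 ^ n. w $ k) = complex_of_real (r * cos \<phi> - sin \<phi>)" .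
  have "sqrt M * sqrt M = M" using M by simp
  then have s2: "sin (2 * grover_angle n) = 2 * r / M"
    by (simp add: sin_double sin_grover_angle cos_grover_angle r_def M_def)
  have c2: "cos (2 * grover_angle n) = 1 - 2 / M"
    by (simp add: cos_double_sin sin_grover_angle power_divide M_def)
  have sin: "sin (\<phi> + 2 * grover_angle n) = 2 / M * (r * cos \<phi> - sin \<phi>) + sin \<phi>"
    unfolding sin_add s2 c2 using M by (simp add: field_simps)
  have "cos (\<phi> + 2 * grover_angle n) = (1 - 2 / M) * (r * b) - 2 / M * r * sin \<phi>"
    unfolding cos_add s2 c2 rb(1) by (simp add: field_simps)
  then have "cos (\<phi> + 2 * grover_angle n) / r = (1 - 2 / M) * b - 2 / M * sin \<phi>"
    using r(1) by (simp add: diff_divide_distrib)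
  also have "\<dots> = 2 / M * ((M - 1) * b - sin \<phi>) - b"
    using M by (simp add: field_simps)
  finally have cos: "cos (\<phi> + 2 * grover_angle n) / r = 2 / M * (r * cos \<phi> - sin \<phi>) - b"
    by (simp add: rb(2))
  have "grover_Q n x0 *\<^sub>v grover_state n x0 \<phi>
      = vec (2 ^ n) (\<lambda>i. 2 / 2 ^ n * (\<Sum>k<2 ^ n. w $ k) - w $ i)"
    unfolding w_def by (rule grover_Q_mult_vec) (use assms in \<open>auto simp: grover_state_def\<close>)
  also have "\<dots> = vec (2 ^ n) (\<lambda>i. complex_of_real
      (2 / M * (r * cos \<phi> - sin \<phi>) - (if i = x0 then - sin \<phi> else b)))"
    unfolding sum by (auto simp: w M_def)
  also have "\<dots> = grover_state n x0 (\<phi> + 2 * grover_angle n)"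
    unfolding grover_state_def M_def[symmetric] r_def[symmetric] sin cos by auto
  finally show ?thesis .
qed

lemma grover_Q_pow_state:
  assumes "n \<ge> 1" "x0 < 2 ^ n"
  shows "(grover_Q n x0 ^\<^sub>m k) *\<^sub>v grover_state n x0 \<phi> = grover_state n x0 (\<phi> + 2 * real k * grover_angle n)"
\<comment> \<open>The power peels off the Q applied first, so the induction hypothesis is used at a
  shifted angle.\<close>
proof (induction k arbitrary: \<phi>)
  case 0
  show ?case by (simp add: grover_state_def carrier_matD[OF grover_Q_carrier])
next
  case (Suc k)
  have v: "grover_state n x0 \<phi> \<in> carrier_vec (2 ^ n)" by (simp add: grover_state_def)
  have "(grover_Q n x0 ^\<^sub>m Suc k) *\<^sub>v grover_state n x0 \<phi>
      = (grover_Q n x0 ^\<^sub>m k) *\<^sub>v (grover_Q n x0 *\<^sub>v grover_state n x0 \<phi>)"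
    using assoc_mult_mat_vec[OF pow_carrier_mat[OF grover_Q_carrier] grover_Q_carrier v] by simp
  then show ?case
    by (simp add: grover_Q_state[OF assms] Suc.IH algebra_simps)
qed

text \<open>The \<open>2 ^ n - 1\<close> wrong outcomes are equally likely, and their number cancels
  the normalization.\<close>

lemma error_prob_grover_state:
  assumes "n \<ge> 1" "x0 < 2 ^ n"
  shows "error_prob (grover_state n x0 \<phi>) x0 = (cos \<phi>)\<^sup>2"
proof -
  have M: "(2::real) ^ n \<ge> 2" by (rule two_le_power[OF assms(1)])
  have "error_prob (grover_state n x0 \<phi>) x0 = (\<Sum>x\<in>{0..<2 ^ n} - {x0}. (cos \<phi>)\<^sup>2 / (2 ^ n - 1))"
    using M unfolding error_prob_def outcome_prob_def
    by (intro sum.cong)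
      (auto simp: grover_state_def inner_unit_vec norm_divide power_divide)
  then show ?thesis
    using assms M by (simp add: of_nat_diff)
qed

section \<open>The number of iterations\<close>

text \<open>The lower bound is sin x \<le> x; the upper one holds as 1 / sqrt 2 is the sine of pi /
  4. They give positivity, the bound on the step count, and room for monotonicity of sine.\<close>

lemma grover_angle_bounds:
  assumes "n \<ge> 1"
  shows "1 / sqrt (2 ^ n) \<le> grover_angle n" "grover_angle n \<le> pi / 4"
proof -
  have "1 / sqrt (2 ^ n) \<le> 1" by simp
  then have nonneg: "0 \<le> grover_angle n"
    unfolding grover_angle_def by (intro arcsin_nonneg) auto
  then show "1 / sqrt (2 ^ n) \<le> grover_angle n"
    using sin_x_le_x[of "grover_angle n"] by (simp add: sin_grover_angle)
  have "(2::real) \<le> 2 ^ n" by (rule two_le_power[OF assms])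
  then have "1 / sqrt (2 ^ n) \<le> 1 / sqrt 2"
    by (intro divide_left_mono) auto
  also have "1 / sqrt 2 = sin (pi / 4)"
    by (simp add: sin_45 real_div_sqrt field_simps)
  finally have "grover_angle n \<le> arcsin (sin (pi / 4))"
    unfolding grover_angle_def by (intro arcsin_le_arcsin) (auto intro: order_trans[of _ 0])
  also have "\<dots> = pi / 4" by (rule arcsin_sin) auto
  finally show "grover_angle n \<le> pi / 4" .
qed

lemma grover_K_near:
  assumes "nearest_rounding rnd" "n \<ge> 1"
  shows "\<bar>real (grover_K rnd n) - (pi / (4 * grover_angle n) - 1 / 2)\<bar> \<le> 1 / 2"
proof -
  define y where "y = pi / (4 * grover_angle n) - 1 / 2"
  \<comment> \<open>The comparison integer is \<open>round y\<close>, which lies within 1 / 2 of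
    \<open>y\<close>.\<close>
  have near: "\<bar>real_of_int (rnd y) - y\<bar> \<le> 1 / 2"
    using assms(1) of_int_round_abs_le[of y] unfolding nearest_rounding_def by (meson order_trans)
  have "0 < 1 / sqrt (2 ^ n)" by simp
  then have "0 < grover_angle n"
    using grover_angle_bounds(1)[OF assms(2)] by linarith
  \<comment> \<open>An angle of at most pi / 4 makes the quotient at least 1, so the rounded value
    is nonnegative and \<open>nat\<close> does not truncate.\<close>
  then have "1 / 2 \<le> y"
    using grover_angle_bounds(2)[OF assms(2)] by (simp add: y_def field_simps)
  then have "0 \<le> rnd y" using near by linarith
  then have "real (grover_K rnd n) = real_of_int (rnd y)"
    by (simp add: grover_K_def y_def grover_angle_def)
  then show ?thesis using near by (simp add: y_def)
qed

lemma grover_K_le: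
  assumes "nearest_rounding rnd" "n \<ge> 1"
  shows "real (grover_K rnd n) \<le> sqrt (2 ^ n)"
proof -
  have "real (grover_K rnd n) \<le> pi / (4 * grover_angle n)"
    using grover_K_near[OF assms] by linarith
  also have "\<dots> \<le> pi / (4 * (1 / sqrt (2 ^ n)))"
    by (intro divide_left_mono mult_pos_pos mult_left_mono grover_angle_bounds(1) assms)
      (auto intro!: less_le_trans[OF _ grover_angle_bounds(1)[OF assms(2)]])
  also have "\<dots> = pi / 4 * sqrt (2 ^ n)" by simp
  also have "\<dots> \<le> 1 * sqrt (2 ^ n)"
    using pi_less_4 by (intro mult_right_mono) auto
  finally show ?thesis by simp
qed

lemma cos_grover_final_angle:
  assumes "nearest_rounding rnd" "n \<ge> 1"
  defines "\<theta> \<equiv> grover_angle n"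
  shows "(cos (\<theta> + 2 * real (grover_K rnd n) * \<theta>))\<^sup>2 \<le> 1 / 2 ^ n"
proof -
  define \<alpha> where "\<alpha> = pi / 2 - (\<theta> + 2 * real (grover_K rnd n) * \<theta>)"
  have "0 < 1 / sqrt (2 ^ n)" by simp
  then have pos: "0 < \<theta>" and le: "\<theta> \<le> pi / 4"
    using grover_angle_bounds[OF assms(2)] unfolding \<theta>_def by linarith+
  \<comment> \<open>The real number \<open>pi / (4 * \<theta>) - 1 / 2\<close> of steps would reach
    pi / 2 exactly, so the deviation is the rounding error times the rotation angle, up to
    sign.\<close>
  have "\<alpha> = - 2 * \<theta> * (real (grover_K rnd n) - (pi / (4 * \<theta>) - 1 / 2))"
    using pos by (simp add: \<alpha>_def field_simps)
  then have "\<bar>\<alpha>\<bar> = 2 * \<theta> * \<bar>real (grover_K rnd n) - (pi / (4 * \<theta>) - 1 / 2)\<bar>"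
    using pos by (simp add: abs_mult)
  also have "\<dots> \<le> 2 * \<theta> * (1 / 2)"
    using grover_K_near[OF assms(1,2)] pos unfolding \<theta>_def by (intro mult_left_mono) auto
  finally have \<alpha>: "\<bar>\<alpha>\<bar> \<le> \<theta>" by simp
  have "cos (\<theta> + 2 * real (grover_K rnd n) * \<theta>) = sin \<alpha>"
    by (simp add: \<alpha>_def sin_diff)
  then have "(cos (\<theta> + 2 * real (grover_K rnd n) * \<theta>))\<^sup>2 = (sin \<bar>\<alpha>\<bar>)\<^sup>2"
    by (simp add: abs_if)
  \<comment> \<open>Sine is nonnegative and increasing up to pi / 2, and \<theta> stays below
    that.\<close>
  also have "\<dots> \<le> (sin \<theta>)\<^sup>2"
    using \<alpha> le by (intro power_mono sin_monotone_2pi_le sin_ge_zero) auto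
  also have "\<dots> = 1 / 2 ^ n"
    by (simp add: \<theta>_def sin_grover_angle power_divide)
  finally show ?thesis .
qed

section \<open>Cost of the circuit\<close>

lemma total_cost_grover_circuit:
  "total_cost c (grover_circuit k) = c Hadamard + k * (c Oracle + 2 * c Hadamard + c Neg_I0)"
  by (induction k) (auto simp: total_cost_def grover_circuit_def algebra_simps)

lemma total_cost_grover_le:
  assumes "nearest_rounding rnd" "n \<ge> 1"
    and H: "real (cost Hadamard) \<le> c * real n"
    and I: "real (cost Neg_I0) \<le> c" and O: "real (cost Oracle) \<le> c"
  shows "real (total_cost cost (grover_circuit (grover_K rnd n)))
    \<le> 5 * c * (sqrt (2 ^ n) * log 2 (2 ^ n))"
proof -
  have c: "0 \<le> c" using I of_nat_0_le_iff order_trans by blast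
  \<comment> \<open>As \<open>n \<ge> 1\<close>, the constant costs are absorbed too: each of the
    four operations of an iteration costs at most \<open>c * real n\<close>.\<close>
  have cn: "c \<le> c * real n"
    using mult_left_mono[OF _ c, of 1 "real n"] assms(2) by simp
  have sq: "1 \<le> sqrt (2 ^ n)" by simp
  have "real (total_cost cost (grover_circuit (grover_K rnd n)))
      = real (cost Hadamard) + real (grover_K rnd n)
          * (real (cost Oracle) + 2 * real (cost Hadamard) + real (cost Neg_I0))"
    by (simp add: total_cost_grover_circuit)
  also have "\<dots> \<le> c * real n + sqrt (2 ^ n) * (4 * (c * real n))"
    using grover_K_le[OF assms(1,2)] H I O cn by (intro add_mono mult_mono) auto
  \<comment> \<open>The initial Hadamard transform is charged one further
    \<open>sqrt (2 ^ n) * (c * real n)\<close>, which makes the factor 5.\<close>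
  also have "\<dots> \<le> sqrt (2 ^ n) * (c * real n) + sqrt (2 ^ n) * (4 * (c * real n))"
    using mult_right_mono[OF sq, of "c * real n"] c by (intro add_right_mono) simp
  finally show ?thesis by (simp add: log_nat_power algebra_simps)
qed

theorem theorem2:
  fixes rnd :: "real \<Rightarrow> int"
  assumes "nearest_rounding rnd"
  shows "(\<forall>n\<ge>1. \<forall>x0<2 ^ n.
            error_prob ((grover_Q n x0 ^\<^sub>m grover_K rnd n) *\<^sub>v grover_start n) x0 \<le> 1 / 2 ^ n) \<and>
         (\<forall>cost. admissible_cost cost \<longrightarrow>
            (\<exists>C::real. \<forall>n\<ge>1. \<forall>x0<2 ^ n.
               real (total_cost (cost n x0) (grover_circuit (grover_K rnd n)))
                 \<le> C * (sqrt (2 ^ n) * log 2 (2 ^ n))))"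
proof (intro conjI allI impI)
  fix n x0 :: nat assume n: "n \<ge> 1" "x0 < 2 ^ n"
  show "error_prob ((grover_Q n x0 ^\<^sub>m grover_K rnd n) *\<^sub>v grover_start n) x0 \<le> 1 / 2 ^ n"
    unfolding grover_start_state[OF n(1), of x0] grover_Q_pow_state[OF n] error_prob_grover_state[OF n]
    by (rule cos_grover_final_angle[OF assms n(1)])
next
  fix cost assume "admissible_cost cost"
  then obtain c :: real where "\<forall>n\<ge>1. \<forall>x0<2 ^ n. real (cost n x0 Hadamard) \<le> c * real n \<and>
      real (cost n x0 Neg_I0) \<le> c \<and> real (cost n x0 Oracle) \<le> c"
    unfolding admissible_cost_def by blast
  \<comment> \<open>The witness is \<open>5 * c\<close>; since \<open>c\<close> is uniform in
    \<open>n\<close> and \<open>x0\<close>, so is the bound.\<close>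
  then show "\<exists>C::real. \<forall>n\<ge>1. \<forall>x0<2 ^ n. real (total_cost (cost n x0) (grover_circuit (grover_K rnd n)))
      \<le> C * (sqrt (2 ^ n) * log 2 (2 ^ n))"
    using total_cost_grover_le[OF assms] by blast
qed

end
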